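(* For any real numbers $p\geq 0$ and $\omega<p$, one has \[ \sup_{0\neq b\in\ell^{p}(\mathbb{Z})}\frac{1}{\|b\|_{\ell^{p}}^{p}}\sum_{\lambda\in\sigma_{d}(T(b))}\left(\operatorname{dist}(\lambda,[-2,2])\right)^{\omega}=\infty, \] where the supremum is over complex-valued sequences $b\in\ell^p(\mathbb{Z})$ and $T(b)$ is the discrete Schrödinger operator on $\ell^2(\mathbb{Z})$ with potential $b$.
   Context: Let $\{e_n\}_{n\in\mathbb{Z}}$ be the standard basis of $\ell^2(\mathbb{Z})$. For a complex sequence $b=\{b_n\}_{n\in\mathbb{Z}}\in\ell^p(\mathbb{Z})$, $T(b)$ is the bounded operator on $\ell^2(\mathbb{Z})$ determined by $T(b)e_n=e_{n-1}+b_ne_n+e_{n+1}$, $n\in\mathbb{Z}$. Since $b_n\to0$ as $n\to\pm\infty$, the essential spectrum of $T(b)$ is $[-2,2]$; the discrete spectrum is $\sigma_d(T(b))=\sigma(T(b))\setminus[-2,2]$, an at most countable set of eigenvalues with all accumulation points in $[-2,2]$. The sum runs over the elements of the set $\sigma_d(T(b))$ and takes values in $[0,\infty]$. For $p>0$, $\|b\|_{\ell^p}^p=\sum_{n\in\mathbb{Z}}|b_n|^p$ and $\ell^p(\mathbb{Z})$ is the set of sequences for which this is finite; for $p=0$, $\|b\|_{\ell^p}^p$ is read as the number of indices $n$ with $b_n\neq0$, and $\ell^0(\mathbb{Z})$ as the set of finitely supported sequences. *)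

theory Defs
  imports "HOL-Analysis.Analysis"
begin

section \<open>The Hilbert space \<open>\<ell>\<^sup>2(\<int>)\<close> and its bounded operators\<close>

definition ell2 :: "(int \<Rightarrow> complex) set" where
  "ell2 = {x. (\<lambda>n. (cmod (x n))\<^sup>2) summable_on UNIV}"

definition ell2_norm :: "(int \<Rightarrow> complex) \<Rightarrow> real" where
  "ell2_norm x = sqrt (\<Sum>\<^sub>\<infinity>n. (cmod (x n))\<^sup>2)"

definition unit_seq :: "int \<Rightarrow> int \<Rightarrow> complex" where
  "unit_seq k = (\<lambda>n. if n = k then 1 else 0)"

text \<open>Operators are functions on all sequences of which only the restriction to \<^term>\<open>ell2\<close> matters.\<close>

definition bounded_op :: "((int \<Rightarrow> complex) \<Rightarrow> (int \<Rightarrow> complex)) \<Rightarrow> bool" where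
  "bounded_op A \<longleftrightarrow>
     (\<forall>x\<in>ell2. A x \<in> ell2) \<and>
     (\<forall>x\<in>ell2. \<forall>y\<in>ell2. A (\<lambda>n. x n + y n) = (\<lambda>n. A x n + A y n)) \<and>
     (\<forall>c. \<forall>x\<in>ell2. A (\<lambda>n. c * x n) = (\<lambda>n. c * A x n)) \<and>
     (\<exists>C. \<forall>x\<in>ell2. ell2_norm (A x) \<le> C * ell2_norm x)"

definition op_resolvent_set :: "((int \<Rightarrow> complex) \<Rightarrow> (int \<Rightarrow> complex)) \<Rightarrow> complex set" where
  "op_resolvent_set A = {z. \<exists>R. bounded_op R \<and>
     (\<forall>x\<in>ell2. R (\<lambda>n. A x n - z * x n) = x \<and> (\<lambda>n. A (R x) n - z * R x n) = x)}"

definition op_spectrum :: "((int \<Rightarrow> complex) \<Rightarrow> (int \<Rightarrow> complex)) \<Rightarrow> complex set" where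
  "op_spectrum A = - op_resolvent_set A"


section \<open>The discrete Schroedinger operator\<close>

text \<open>The coordinate form of \<open>T(b) e\<^sub>n = e\<^sub>n\<^sub>-\<^sub>1 + b\<^sub>n e\<^sub>n + e\<^sub>n\<^sub>+\<^sub>1\<close>; that for bounded \<open>b\<close> it is the unique
  bounded operator on \<open>\<ell>\<^sup>2(\<int>)\<close> with this action on the basis is proved at the end.\<close>

definition schroedinger :: "(int \<Rightarrow> complex) \<Rightarrow> (int \<Rightarrow> complex) \<Rightarrow> (int \<Rightarrow> complex)" where
  "schroedinger b x = (\<lambda>n. x (n - 1) + b n * x n + x (n + 1))"

text \<open>The interval \<open>[-2,2]\<close> as a subset of the complex plane.\<close>

definition ess_interval :: "complex set" where
  "ess_interval = complex_of_real ` {-2..2}"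

definition discrete_spectrum :: "(int \<Rightarrow> complex) \<Rightarrow> complex set" where
  "discrete_spectrum b = op_spectrum (schroedinger b) - ess_interval"


section \<open>The sequence spaces \<open>\<ell>\<^sup>p(\<int>)\<close> for \<open>p \<ge> 0\<close>\<close>

definition lp_space :: "real \<Rightarrow> (int \<Rightarrow> complex) set" where
  "lp_space p = (if p = 0 then {b. finite {n. b n \<noteq> 0}}
                 else {b. (\<lambda>n. cmod (b n) powr p) summable_on UNIV})"

text \<open>This is \<open>\<parallel>b\<parallel>\<^sub>p\<^sup>p\<close>, without the \<open>p\<close>-th root; only meaningful on \<^term>\<open>lp_space p\<close>.\<close>

definition lp_norm_pow :: "real \<Rightarrow> (int \<Rightarrow> complex) \<Rightarrow> real" where
  "lp_norm_pow p b = (if p = 0 then real (card {n. b n \<noteq> 0})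
                      else (\<Sum>\<^sub>\<infinity>n. cmod (b n) powr p))"


section \<open>The operator is well defined and determined by its action on the basis\<close>

lemma lp_space_bounded:
  assumes "p \<ge> 0" "b \<in> lp_space p"
  shows "\<exists>B. \<forall>n. cmod (b n) \<le> B"
proof (cases "p = 0")
  case True
  then have fin: "finite {n. b n \<noteq> 0}"
    using assms by (simp add: lp_space_def)
  have "cmod (b n) \<le> (\<Sum>k\<in>{n. b n \<noteq> 0}. cmod (b k))" for n
  proof (cases "b n = 0")
    case True
    then show ?thesis by (simp add: sum_nonneg)
  next
    case False
    then show ?thesis by (intro member_le_sum) (use fin in auto)
  qed
  then show ?thesis by blast
next
  case False
  with assms have p: "p > 0" and s: "(\<lambda>n. cmod (b n) powr p) summable_on UNIV"
    by (auto simp: lp_space_def)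
  define S where "S = (\<Sum>\<^sub>\<infinity>n. cmod (b n) powr p)"
  have "cmod (b n) \<le> S powr (1 / p)" for n
  proof -
    have "sum (\<lambda>n. cmod (b n) powr p) {n} \<le> S"
      unfolding S_def by (intro finite_sum_le_infsum s) auto
    then have "(cmod (b n) powr p) powr (1 / p) \<le> S powr (1 / p)"
      using p by (intro powr_mono2) auto
    then show ?thesis using p by (simp add: powr_powr)
  qed
  then show ?thesis by blast
qed

lemma schroedinger_unit_seq:
  "schroedinger b (unit_seq k) =
     (\<lambda>n. unit_seq (k - 1) n + b k * unit_seq k n + unit_seq (k + 1) n)"
  by (auto simp: schroedinger_def unit_seq_def)

lemma ell2_norm_sq: "(ell2_norm x)\<^sup>2 = (\<Sum>\<^sub>\<infinity>n. (cmod (x n))\<^sup>2)"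
  unfolding ell2_norm_def by (simp add: infsum_nonneg)

lemma ell2_norm_nonneg: "0 \<le> ell2_norm x"
  unfolding ell2_norm_def by (simp add: infsum_nonneg)

lemma cmod_sum3_sq_le: "(cmod (u + v + w))\<^sup>2 \<le> 3 * ((cmod u)\<^sup>2 + (cmod v)\<^sup>2 + (cmod w)\<^sup>2)"
proof -
  have "cmod (u + v + w) \<le> cmod u + cmod v + cmod w"
    using norm_triangle_ineq[of "u + v" w] norm_triangle_ineq[of u v] by linarith
  then have "(cmod (u + v + w))\<^sup>2 \<le> (cmod u + cmod v + cmod w)\<^sup>2"
    by (intro power_mono) auto
  also have "\<dots> \<le> 3 * ((cmod u)\<^sup>2 + (cmod v)\<^sup>2 + (cmod w)\<^sup>2)"
    using zero_le_power2[of "cmod u - cmod v"] zero_le_power2[of "cmod u - cmod w"]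
      zero_le_power2[of "cmod v - cmod w"]
    by (simp add: power2_eq_square algebra_simps)
  finally show ?thesis .
qed

lemma ell2_scale: "x \<in> ell2 \<Longrightarrow> (\<lambda>n. c * x n) \<in> ell2"
  by (simp add: ell2_def norm_mult power_mult_distrib summable_on_cmult_right)

lemma ell2_add3:
  assumes "x \<in> ell2" "y \<in> ell2" "z \<in> ell2"
  shows "(\<lambda>n. x n + y n + z n) \<in> ell2"
    and "(ell2_norm (\<lambda>n. x n + y n + z n))\<^sup>2
           \<le> 3 * ((ell2_norm x)\<^sup>2 + (ell2_norm y)\<^sup>2 + (ell2_norm z)\<^sup>2)"
proof -
  let ?f = "\<lambda>x n. (cmod (x n))\<^sup>2"
  have s: "?f x summable_on UNIV" "?f y summable_on UNIV" "?f z summable_on UNIV"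
    using assms by (auto simp: ell2_def)
  have s2: "(\<lambda>n. 3 * (?f x n + ?f y n + ?f z n)) summable_on UNIV"
    using s by (intro summable_on_cmult_right summable_on_add)
  have s3: "(\<lambda>n. (cmod (x n + y n + z n))\<^sup>2) summable_on UNIV"
    by (rule summable_on_comparison_test[OF s2]) (use cmod_sum3_sq_le in blast, simp)
  then show "(\<lambda>n. x n + y n + z n) \<in> ell2"
    by (simp add: ell2_def)
  have "(\<Sum>\<^sub>\<infinity>n. (cmod (x n + y n + z n))\<^sup>2) \<le> (\<Sum>\<^sub>\<infinity>n. 3 * (?f x n + ?f y n + ?f z n))"
    by (rule infsum_mono[OF s3 s2]) (rule cmod_sum3_sq_le)
  also have "\<dots> = 3 * ((\<Sum>\<^sub>\<infinity>n. ?f x n) + (\<Sum>\<^sub>\<infinity>n. ?f y n) + (\<Sum>\<^sub>\<infinity>n. ?f z n))"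
    using s by (simp add: infsum_cmult_right' infsum_add summable_on_add del: distrib_left_numeral)
  finally show "(ell2_norm (\<lambda>n. x n + y n + z n))\<^sup>2
      \<le> 3 * ((ell2_norm x)\<^sup>2 + (ell2_norm y)\<^sup>2 + (ell2_norm z)\<^sup>2)"
    by (simp add: ell2_norm_sq)
qed

lemma ell2_add: "x \<in> ell2 \<Longrightarrow> y \<in> ell2 \<Longrightarrow> (\<lambda>n. x n + y n) \<in> ell2"
  using ell2_add3(1)[of x y "\<lambda>_. 0"] by (simp add: ell2_def)

lemma ell2_shift:
  assumes "x \<in> ell2"
  shows "(\<lambda>n. x (n + k)) \<in> ell2" and "ell2_norm (\<lambda>n. x (n + k)) = ell2_norm x"
proof -
  have bij: "bij_betw (\<lambda>n::int. n + k) UNIV UNIV"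
    by (rule bij_betwI[where g = "\<lambda>n. n - k"]) auto
  show "(\<lambda>n. x (n + k)) \<in> ell2"
    using assms summable_on_reindex_bij_betw[OF bij, of "\<lambda>n. (cmod (x n))\<^sup>2"]
    by (simp add: ell2_def)
  show "ell2_norm (\<lambda>n. x (n + k)) = ell2_norm x"
    using infsum_reindex_bij_betw[OF bij, of "\<lambda>n. (cmod (x n))\<^sup>2"]
    by (simp add: ell2_norm_def)
qed

lemma ell2_mult_bounded:
  assumes "x \<in> ell2" "\<And>n. cmod (b n) \<le> B"
  shows "(\<lambda>n. b n * x n) \<in> ell2" and "(ell2_norm (\<lambda>n. b n * x n))\<^sup>2 \<le> B\<^sup>2 * (ell2_norm x)\<^sup>2"
proof -
  have le: "(cmod (b n * x n))\<^sup>2 \<le> B\<^sup>2 * (cmod (x n))\<^sup>2" for n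
    unfolding norm_mult power_mult_distrib
    by (intro mult_right_mono power_mono assms) auto
  have s: "(\<lambda>n. B\<^sup>2 * (cmod (x n))\<^sup>2) summable_on UNIV"
    using assms(1) by (intro summable_on_cmult_right) (simp add: ell2_def)
  have s2: "(\<lambda>n. (cmod (b n * x n))\<^sup>2) summable_on UNIV"
    by (rule summable_on_comparison_test[OF s]) (auto intro: le)
  then show "(\<lambda>n. b n * x n) \<in> ell2"
    by (simp add: ell2_def)
  have "(\<Sum>\<^sub>\<infinity>n. (cmod (b n * x n))\<^sup>2) \<le> (\<Sum>\<^sub>\<infinity>n. B\<^sup>2 * (cmod (x n))\<^sup>2)"
    by (rule infsum_mono[OF s2 s]) (rule le)
  then show "(ell2_norm (\<lambda>n. b n * x n))\<^sup>2 \<le> B\<^sup>2 * (ell2_norm x)\<^sup>2"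
    by (simp add: ell2_norm_sq infsum_cmult_right')
qed

lemma bounded_op_schroedinger:
  assumes "\<And>n. cmod (b n) \<le> B"
  shows "bounded_op (schroedinger b)"
  unfolding bounded_op_def
proof (intro conjI ballI allI)
  fix x assume x: "x \<in> ell2"
  show "schroedinger b x \<in> ell2"
    unfolding schroedinger_def
    using ell2_add3(1)[OF ell2_shift(1)[OF x, of "-1"] ell2_mult_bounded(1)[of x b B, OF x assms]
        ell2_shift(1)[OF x, of 1]] by simp
next
  show "\<exists>C. \<forall>x\<in>ell2. ell2_norm (schroedinger b x) \<le> C * ell2_norm x"
  proof (intro exI[of _ "sqrt (3 * (2 + B\<^sup>2))"] ballI)
    fix x assume x: "x \<in> ell2"
    have "(ell2_norm (schroedinger b x))\<^sup>2
        \<le> 3 * ((ell2_norm x)\<^sup>2 + (ell2_norm (\<lambda>n. b n * x n))\<^sup>2 + (ell2_norm x)\<^sup>2)"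
      unfolding schroedinger_def
      using ell2_add3(2)[OF ell2_shift(1)[OF x, of "-1"] ell2_mult_bounded(1)[of x b B, OF x assms]
          ell2_shift(1)[OF x, of 1]]
        ell2_shift(2)[OF x, of "-1"] ell2_shift(2)[OF x, of 1] by simp
    also have "\<dots> \<le> (3 * (2 + B\<^sup>2)) * (ell2_norm x)\<^sup>2"
      using ell2_mult_bounded(2)[of x b B, OF x assms] by (simp add: algebra_simps)
    also have "\<dots> = (sqrt (3 * (2 + B\<^sup>2)) * ell2_norm x)\<^sup>2"
      by (simp add: power_mult_distrib)
    finally show "ell2_norm (schroedinger b x) \<le> sqrt (3 * (2 + B\<^sup>2)) * ell2_norm x"
      by (rule power2_le_imp_le) (simp add: ell2_norm_nonneg)
  qed
qed (simp_all add: schroedinger_def fun_eq_iff ring_distribs mult.left_commute)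

lemma cmod_le_ell2_norm:
  assumes "x \<in> ell2"
  shows "cmod (x n) \<le> ell2_norm x"
proof -
  have "sum (\<lambda>n. (cmod (x n))\<^sup>2) {n} \<le> (ell2_norm x)\<^sup>2"
    unfolding ell2_norm_sq using assms by (intro finite_sum_le_infsum) (auto simp: ell2_def)
  then have "(cmod (x n))\<^sup>2 \<le> (ell2_norm x)\<^sup>2" by simp
  then show ?thesis
    by (rule power2_le_imp_le) (rule ell2_norm_nonneg)
qed

lemma bounded_op_zero_on_basis:
  assumes D: "bounded_op D" and z: "\<And>k. D (unit_seq k) = (\<lambda>_. 0)" and x: "x \<in> ell2"
  shows "D x = (\<lambda>_. 0)"
proof -
  define r where "r F = (\<lambda>n. if n \<in> F then x n else 0)" for F
  have r2: "r F \<in> ell2" for F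
  proof -
    have "(\<lambda>n. (if n \<in> F then 1 else 0) * x n) \<in> ell2"
      by (rule ell2_mult_bounded(1)[OF x, where B = 1]) auto
    also have "(\<lambda>n. (if n \<in> F then 1 else 0) * x n) = r F"
      by (auto simp: r_def)
    finally show ?thesis .
  qed
  have u2: "unit_seq k \<in> ell2" for k
  proof -
    have "(\<lambda>n. (cmod (unit_seq k n))\<^sup>2) summable_on UNIV \<longleftrightarrow> (\<lambda>_. 1 :: real) summable_on {k}"
      by (rule summable_on_cong_neutral) (auto simp: unit_seq_def)
    then show ?thesis by (simp add: ell2_def)
  qed
  have Dadd: "D (\<lambda>n. y n + w n) = (\<lambda>n. D y n + D w n)" if "y \<in> ell2" "w \<in> ell2" for y w
    using D that by (auto simp: bounded_op_def)
  have Dsc: "D (\<lambda>n. c * y n) = (\<lambda>n. c * D y n)" if "y \<in> ell2" for c y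
    using D that by (auto simp: bounded_op_def)
  obtain C0 where C0: "\<And>y. y \<in> ell2 \<Longrightarrow> ell2_norm (D y) \<le> C0 * ell2_norm y"
    using D unfolding bounded_op_def by blast
  define C where "C = \<bar>C0\<bar> + 1"
  have C: "ell2_norm (D y) \<le> C * ell2_norm y" if "y \<in> ell2" for y
    using C0[OF that] mult_right_mono[of C0 C "ell2_norm y"] ell2_norm_nonneg[of y]
    unfolding C_def by linarith
  have Cpos: "C > 0" by (simp add: C_def)
  have fin: "D (r F) = (\<lambda>_. 0)" if "finite F" for F
    using that
  proof (induction F rule: finite_induct)
    case empty
    have "r {} = (\<lambda>n. 0 * x n)" by (simp add: r_def)
    then show ?case using Dsc[OF x, of 0] by simp
  next
    case (insert k F)
    then have "r (insert k F) = (\<lambda>n. r F n + x k * unit_seq k n)"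
      by (auto simp: r_def unit_seq_def)
    then show ?case
      using Dadd[OF r2[of F] ell2_scale[OF u2, of "x k" k]] Dsc[OF u2, of "x k" k] insert.IH
      by (simp add: z)
  qed
  have "cmod (D x n) \<le> C * e" if "e > 0" for n e
  proof -
    define f where "f = (\<lambda>n. (cmod (x n))\<^sup>2)"
    have f: "f summable_on UNIV" using x by (simp add: f_def ell2_def)
    have e2: "e\<^sup>2 > 0" using that by simp
    obtain F where F: "finite F" "dist (sum f F) (infsum f UNIV) \<le> e\<^sup>2"
      using infsum_finite_approximation[OF f e2] by auto
    have eq: "x = (\<lambda>n. r F n + r (- F) n)" by (auto simp: r_def)
    have "D x = (\<lambda>n. D (r F) n + D (r (- F)) n)"
      using Dadd[OF r2[of F] r2[of "- F"]] by (simp flip: eq)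
    then have Deq: "D x = D (r (- F))" by (simp add: fin[OF F(1)])
    have "infsum f UNIV = infsum f F + infsum f (- F)"
      using infsum_Un_disjoint[of f F "- F"] F(1) summable_on_subset_banach[OF f, of "- F"]
      by simp
    then have "infsum f (- F) \<le> e\<^sup>2"
      using F by (simp add: dist_real_def)
    moreover have "(ell2_norm (r (- F)))\<^sup>2 = infsum f (- F)"
      unfolding ell2_norm_sq f_def by (rule infsum_cong_neutral) (auto simp: r_def)
    ultimately have "(ell2_norm (r (- F)))\<^sup>2 \<le> e\<^sup>2" by simp
    then have "ell2_norm (r (- F)) \<le> e"
      by (rule power2_le_imp_le) (use that in simp)
    then have "C * ell2_norm (r (- F)) \<le> C * e"
      using Cpos by simp
    moreover have "cmod (D (r (- F)) n) \<le> ell2_norm (D (r (- F)))"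
      by (rule cmod_le_ell2_norm) (use D r2 in \<open>auto simp: bounded_op_def\<close>)
    ultimately show ?thesis
      using C[OF r2[of "- F"]] by (simp add: Deq)
  qed
  note bound = this
  have "cmod (D x n) \<le> 0" for n
  proof (rule field_le_epsilon)
    fix e :: real assume "e > 0"
    then show "cmod (D x n) \<le> 0 + e"
      using bound[of "e / C" n] Cpos by simp
  qed
  then show ?thesis by auto
qed

lemma bounded_op_diff:
  assumes A: "bounded_op A" and B: "bounded_op B"
  shows "bounded_op (\<lambda>x n. A x n - B x n)"
  unfolding bounded_op_def
proof (intro conjI ballI allI)
  fix x assume x: "x \<in> ell2"
  have "A x \<in> ell2" "B x \<in> ell2"
    using A B x by (auto simp: bounded_op_def)
  then show "(\<lambda>n. A x n - B x n) \<in> ell2"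
    using ell2_add[OF _ ell2_scale[of "B x" "-1"], of "A x"] by simp
next
  obtain C1 where C1: "\<And>x. x \<in> ell2 \<Longrightarrow> ell2_norm (A x) \<le> C1 * ell2_norm x"
    using A unfolding bounded_op_def by blast
  obtain C2 where C2: "\<And>x. x \<in> ell2 \<Longrightarrow> ell2_norm (B x) \<le> C2 * ell2_norm x"
    using B unfolding bounded_op_def by blast
  show "\<exists>C. \<forall>x\<in>ell2. ell2_norm (\<lambda>n. A x n - B x n) \<le> C * ell2_norm x"
  proof (intro exI[of _ "sqrt (3 * (C1\<^sup>2 + C2\<^sup>2))"] ballI)
    fix x assume x: "x \<in> ell2"
    have AB: "A x \<in> ell2" "B x \<in> ell2"
      using A B x by (auto simp: bounded_op_def)
    have z: "(\<lambda>_. 0) \<in> ell2" "ell2_norm (\<lambda>_. 0) = 0"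
      by (auto simp: ell2_def ell2_norm_def)
    have m: "ell2_norm (\<lambda>n. - 1 * B x n) = ell2_norm (B x)"
      by (simp add: ell2_norm_def)
    have "(ell2_norm (A x))\<^sup>2 \<le> (C1 * ell2_norm x)\<^sup>2" "(ell2_norm (B x))\<^sup>2 \<le> (C2 * ell2_norm x)\<^sup>2"
      using C1[OF x] C2[OF x] by (auto intro: power_mono ell2_norm_nonneg)
    then have "(ell2_norm (\<lambda>n. A x n - B x n))\<^sup>2 \<le> 3 * ((C1 * ell2_norm x)\<^sup>2 + (C2 * ell2_norm x)\<^sup>2)"
      using ell2_add3(2)[OF AB(1) ell2_scale[OF AB(2), of "-1"] z(1)] z(2) m by simp
    also have "\<dots> = (sqrt (3 * (C1\<^sup>2 + C2\<^sup>2)) * ell2_norm x)\<^sup>2"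
      by (simp add: power_mult_distrib algebra_simps)
    finally show "ell2_norm (\<lambda>n. A x n - B x n) \<le> sqrt (3 * (C1\<^sup>2 + C2\<^sup>2)) * ell2_norm x"
      by (rule power2_le_imp_le) (simp add: ell2_norm_nonneg)
  qed
qed (use A B in \<open>simp_all add: bounded_op_def right_diff_distrib fun_eq_iff\<close>)

lemma schroedinger_unique:
  assumes p: "p \<ge> 0" "b \<in> lp_space p" and A: "bounded_op A"
    and "\<And>k. A (unit_seq k) = (\<lambda>n. unit_seq (k - 1) n + b k * unit_seq k n + unit_seq (k + 1) n)"
    and x: "x \<in> ell2"
  shows "A x = schroedinger b x"
proof -
  obtain B where "\<And>n. cmod (b n) \<le> B"
    using lp_space_bounded[OF p] by blast
  then have T: "bounded_op (schroedinger b)" by (rule bounded_op_schroedinger)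
  have "(\<lambda>n. A x n - schroedinger b x n) = (\<lambda>_. 0)"
    using bounded_op_zero_on_basis[OF bounded_op_diff[OF A T] _ x] assms(4)
    by (simp add: schroedinger_unit_seq)
  then show ?thesis by (auto simp: fun_eq_iff)
qed

end

theory Submission
  imports Defs
begin

text \<open>
  Let \<open>b = i h\<close> on \<open>{-M..M}\<close> with \<open>h > 0\<close> small. Were the box decoupled from its complement, its
  eigenvalues would be \<open>2 cos a\<^sub>j + i h\<close>, all at distance \<open>h\<close> from \<open>[-2,2]\<close>, so of the order of \<open>M\<close> eigenvalues
  contribute \<open>h\<^sup>\<omega>\<close> each, whereas the norm is of the order \<open>M h\<^sup>p\<close>; the ratio \<open>h\<^sup>\<omega>\<^sup>-\<^sup>p\<close> is unbounded as \<open>h \<rightarrow> 0\<close>.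
  Two barriers of fixed height \<open>-20 i\<close> at \<open>\<plusminus>(M + 1)\<close> replace the decoupling; their cost is
  negligible once \<open>M\<close> is large depending on \<open>h\<close>. For an even eigenvector \<open>cos (n w)\<close>, matched to the
  decaying solution \<open>q\<^sup>-\<^sup>n\<close> outside with \<open>q + 1/q = z = 2 cos w + i h\<close>, the eigenvalue equation reads
  \<open>exp (i (2M+2) w) = - (1 - t exp (i w)) / (1 - t exp (- i w))\<close> with \<open>t = 1/(q + 20 i)\<close>. As \<open>|t| \<le> 1/20\<close>,
  the quotient stays near 1, so taking logarithms gives a continuous fixed point problem
  \<open>w = a\<^sub>j + O(1/M)\<close>, \<open>a\<^sub>j = \<pi> (2j+1)/(2M+2)\<close>, which Brouwer's theorem solves in disjoint discs
  for \<open>j = 0, \<dots>, M\<close>.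
\<close>

section \<open>Square-summable eigenvectors and the spectrum\<close>

lemma eigenvalue_in_op_spectrum:
  assumes x: "x \<in> ell2" "x k \<noteq> 0" and eig: "A x = (\<lambda>n. z * x n)"
  shows "z \<in> op_spectrum A"
proof -
  have False if R: "bounded_op R" "R (\<lambda>n. A x n - z * x n) = x" for R
  proof -
    \<comment> \<open>For an eigenvector, \<open>A x - z x\<close> is the zero sequence; read as
      \<open>0 * x n\<close>, it is sent to zero by homogeneity of \<open>R\<close>, while a
      resolvent would have to return \<open>x\<close>.\<close>
    have "R (\<lambda>n. 0 * x n) = (\<lambda>n. 0 * R x n)"
      using R(1) x(1) unfolding bounded_op_def by blast
    then have "x = (\<lambda>_. 0)" using R(2) eig by simp
    then show False using x(2) by simp
  qed
  then show ?thesis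
    using x(1) unfolding op_spectrum_def op_resolvent_set_def by blast
qed

lemma ell2_even_extension:
  fixes f :: "nat \<Rightarrow> complex"
  assumes "summable (\<lambda>m. (cmod (f m))\<^sup>2)"
  shows "(\<lambda>n::int. f (nat \<bar>n\<bar>)) \<in> ell2"
proof -
  let ?g = "\<lambda>n::int. (cmod (f (nat \<bar>n\<bar>)))\<^sup>2"
  have s: "(\<lambda>m. (cmod (f m))\<^sup>2) summable_on UNIV"
    using assms by (simp add: summable_on_UNIV_nonneg_real_iff)
  have "?g summable_on range int"
    using s by (subst summable_on_reindex) (auto simp: o_def)
  moreover have "?g summable_on range (\<lambda>m. - int m)"
    using s by (subst summable_on_reindex) (auto simp: o_def inj_on_def)
  ultimately have "?g summable_on (range int \<union> range (\<lambda>m. - int m))"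
    by (rule summable_on_union)
  moreover have "range int \<union> range (\<lambda>m. - int m) = UNIV"
    by (auto simp: image_iff) (metis int_cases2)
  ultimately show ?thesis by (simp add: ell2_def)
qed

section \<open>The decaying exterior solution\<close>

text \<open>The branch is chosen so that it is continuous on the upper half plane; \<open>csqrt (z\<^sup>2 - 4)\<close> would jump
  on the imaginary axis.\<close>

definition outer_root :: "complex \<Rightarrow> complex" where
  "outer_root z = (z + \<i> * csqrt (4 - z\<^sup>2)) / 2"

text \<open>A real value of z^2 with Im z > 0 forces Re z = 0, and then 4 - z^2 = 4 + (Im z)^2 is
  positive. This keeps \<open>csqrt\<close> away from its branch cut.\<close>

lemma four_minus_square_notin_nonpos_Reals:
  assumes "Im z > 0"
  shows "4 - z\<^sup>2 \<notin> \<real>\<^sub>\<le>\<^sub>0"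
proof
  assume "4 - z\<^sup>2 \<in> \<real>\<^sub>\<le>\<^sub>0"
  then have "Re (4 - z\<^sup>2) \<le> 0" "Im (4 - z\<^sup>2) = 0"
    by (auto simp: complex_nonpos_Reals_iff)
  then have "Re z = 0" "4 \<le> (Re z)\<^sup>2 - (Im z)\<^sup>2"
    using assms by (auto simp: power2_eq_square)
  then show False by (simp add: power2_eq_square) (smt (verit) zero_le_square)
qed

text \<open>q and z - q are the two roots of X^2 - z X + 1. The principal square root has
  nonnegative real part, so Im q > 0; then Im z = Im q (1 - 1/|q|^2) shows that q is the root
  outside the unit disc.\<close>

lemma outer_root:
  assumes z: "Im z > 0"
  shows outer_root_add_inverse: "outer_root z + 1 / outer_root z = z"
    and Im_outer_root_pos: "Im (outer_root z) > 0"
    and norm_outer_root_gt_1: "cmod (outer_root z) > 1"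
proof -
  define q where "q = outer_root z"
  have q2: "q * (z - q) = 1"
  proof -
    have "q * (z - q) = (z\<^sup>2 + (csqrt (4 - z\<^sup>2))\<^sup>2) / 4"
      by (simp add: q_def outer_root_def field_simps power2_eq_square)
    then show ?thesis by simp
  qed
  then have "q \<noteq> 0" by auto
  then have inv: "1 / q = z - q" using q2 by (simp add: field_simps)
  show "outer_root z + 1 / outer_root z = z" using inv by (simp add: q_def)
  show pos: "Im (outer_root z) > 0"
    using z Re_csqrt[of "4 - z\<^sup>2"] by (simp add: outer_root_def del: csqrt.sel)
  have "Im (1 / q) = - Im q / (cmod q)\<^sup>2"
    by (simp add: Im_divide cmod_def)
  then have "Im z = Im q * (1 - 1 / (cmod q)\<^sup>2)"
    using inv by (simp add: field_simps)
  then have "1 / (cmod q)\<^sup>2 < 1"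
    using z pos by (simp add: q_def zero_less_mult_iff)
  then have "1 < (cmod q)\<^sup>2"
    using \<open>q \<noteq> 0\<close> by (simp add: field_simps)
  then show "cmod (outer_root z) > 1"
    unfolding q_def by (metis norm_ge_zero not_le power_le_one)
qed

lemma continuous_on_outer_root [continuous_intros]:
  assumes "continuous_on S f" "\<And>x. x \<in> S \<Longrightarrow> Im (f x) > 0"
  shows "continuous_on S (\<lambda>x. outer_root (f x))"
proof -
  have "continuous_on S (\<lambda>x. 4 - (f x)\<^sup>2)"
    by (intro continuous_intros assms(1))
  then have *: "continuous_on S (\<lambda>x. csqrt (4 - (f x)\<^sup>2))"
    by (rule continuous_on_compose2[OF continuous_on_csqrt])
      (use assms(2) four_minus_square_notin_nonpos_Reals in auto)
  show ?thesis
    unfolding outer_root_def by (intro continuous_intros assms(1) *) auto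
qed

section \<open>Even eigenvectors of the barrier potential\<close>

text \<open>The imaginary part of \<open>outer_root z + 20 \<i>\<close> exceeds 20 whenever \<open>Im z > 0\<close>: the sign of the
  barrier prevents a resonance with the exterior solution.\<close>

definition barrier_potential :: "real \<Rightarrow> nat \<Rightarrow> int \<Rightarrow> complex" where
  "barrier_potential h M n =
     (if \<bar>n\<bar> \<le> int M then \<i> * of_real h else if \<bar>n\<bar> = int (Suc M) then - 20 * \<i> else 0)"

text \<open>The eigenvector is a cosine up to the barrier and geometric beyond it. The addition
  theorem settles the interior sites and q + 1/q = z the exterior ones, so the only condition left
  is the one at the barrier, which is \<open>quant\<close>.\<close>

lemma barrier_potential_eigenvalue:
  assumes z: "z = 2 * cos w + \<i> * of_real h" "q + 1 / q = z" and q: "cmod q > 1"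
    and quant: "cos (of_nat (Suc M) * w) * (q + 20 * \<i>) = cos (of_nat M * w)"
  shows "z \<in> op_spectrum (schroedinger (barrier_potential h M))"
proof -
  define f where "f m = (if m \<le> M then cos (of_nat m * w)
    else cos (of_nat (Suc M) * w) / q ^ (m - Suc M))" for m
  have q0: "q \<noteq> 0" using q by auto
  \<comment> \<open>The two branches agree at \<open>Suc M\<close>, so the cosine form also holds on
    the barrier itself.\<close>
  have f_cos: "f m = cos (of_nat m * w)" if "m \<le> Suc M" for m
    using that by (auto simp: f_def le_Suc_eq)
  have f_geo: "f m = cos (of_nat (Suc M) * w) / q ^ (m - Suc M)" if "m > M" for m
    using that by (simp add: f_def)
  have "summable (\<lambda>m. (cmod (f (m + Suc M)))\<^sup>2)"
  proof -
    have "(cmod (f (m + Suc M)))\<^sup>2 = (cmod (cos (of_nat (Suc M) * w)))\<^sup>2 * (1 / (cmod q)\<^sup>2) ^ m" for m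
      by (subst f_geo)
        (simp_all add: norm_divide norm_power power_divide mult.commute flip: power_mult)
    moreover have "1 / (cmod q)\<^sup>2 < 1"
      using q one_less_power[of "cmod q" 2] q0 by (subst divide_less_eq_1_pos) auto
    then have "summable (\<lambda>m. (1 / (cmod q)\<^sup>2) ^ m)"
      by (intro summable_geometric) simp
    ultimately show ?thesis by (simp add: summable_mult)
  qed
  then have ell2: "(\<lambda>n. f (nat \<bar>n\<bar>)) \<in> ell2"
    by (rule ell2_even_extension[OF summable_iff_shift[THEN iffD1]])
  have cos_rec: "cos (of_nat (Suc (Suc m)) * w) + cos (of_nat m * w)
      = 2 * cos w * cos (of_nat (Suc m) * w)" for m
    using cos_plus_cos[of "of_nat (Suc (Suc m)) * w" "of_nat m * w"]
    by (simp add: algebra_simps add_divide_distrib)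
  define c where "c = barrier_potential h M \<circ> int"
  \<comment> \<open>By evenness both neighbours of site 0 carry the value
    \<open>f 1\<close>.\<close>
  have rec0: "2 * f 1 + c 0 * f 0 = z * f 0"
    by (simp add: f_cos z(1) c_def barrier_potential_def)
  have rec: "f m + c (Suc m) * f (Suc m) + f (Suc (Suc m)) = z * f (Suc m)" for m
  proof -
    consider "Suc m \<le> M" | "m = M" | "m > M" by linarith
    then show ?thesis
    proof cases
      case 1
      then show ?thesis
        using cos_rec[of m]
        by (simp add: f_cos z(1) c_def barrier_potential_def algebra_simps)
    next
      \<comment> \<open>The barrier site, where f(M) - 20 i f(M+1) + f(M+1)/q must equal (q + 1/q)
        f(M+1).\<close>
      case 2
      have "f M = (q + 20 * \<i>) * f (Suc M)"
        using quant by (simp add: f_cos mult.commute del: of_nat_Suc)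
      moreover have "f (Suc (Suc M)) = f (Suc M) / q"
        by (simp add: f_geo)
      moreover have "c (Suc M) = - 20 * \<i>"
        by (simp add: c_def barrier_potential_def)
      ultimately show ?thesis
        unfolding 2 z(2)[symmetric] by (simp add: field_simps)
    next
      case 3
      then obtain d where d: "m = Suc (M + d)" using less_iff_Suc_add by auto
      then have "f m = q * f (Suc m)" "f (Suc (Suc m)) = f (Suc m) / q" "c (Suc m) = 0"
        using q0 by (simp_all add: f_geo c_def barrier_potential_def)
      then show ?thesis
        unfolding z(2)[symmetric] by (simp add: field_simps)
    qed
  qed
  have "schroedinger (barrier_potential h M) (\<lambda>n. f (nat \<bar>n\<bar>)) n = z * f (nat \<bar>n\<bar>)" for n
  proof -
    have b: "barrier_potential h M n = c (nat \<bar>n\<bar>)"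
      by (simp add: c_def barrier_potential_def)
    show ?thesis
    proof (cases "n = 0")
      case True
      then show ?thesis using rec0 b by (simp add: schroedinger_def algebra_simps)
    next
      case False
      then obtain m where m: "nat \<bar>n\<bar> = Suc m" by (metis not0_implies_Suc zero_less_abs_iff zero_less_nat_eq less_irrefl)
      have "n = int (Suc m) \<or> n = - int (Suc m)" using m by linarith
      then have "f (nat \<bar>n - 1\<bar>) + f (nat \<bar>n + 1\<bar>) = f m + f (Suc (Suc m))"
      proof
        assume "n = int (Suc m)"
        then have "nat \<bar>n - 1\<bar> = m" "nat \<bar>n + 1\<bar> = Suc (Suc m)" by linarith+
        then show ?thesis by (simp only:)
      next
        assume "n = - int (Suc m)"
        then have "nat \<bar>n - 1\<bar> = Suc (Suc m)" "nat \<bar>n + 1\<bar> = m" by linarith+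
        then show ?thesis by (simp only: add.commute)
      qed
      moreover have "schroedinger (barrier_potential h M) (\<lambda>n. f (nat \<bar>n\<bar>)) n
          = (f (nat \<bar>n - 1\<bar>) + f (nat \<bar>n + 1\<bar>)) + c (Suc m) * f (Suc m)"
        by (simp add: schroedinger_def b m)
      ultimately show ?thesis using rec[of m] by (simp add: m ac_simps)
    qed
  qed
  then have "schroedinger (barrier_potential h M) (\<lambda>n. f (nat \<bar>n\<bar>)) = (\<lambda>n. z * f (nat \<bar>n\<bar>))" ..
  then show ?thesis
    by (rule eigenvalue_in_op_spectrum[OF ell2, of 0, rotated]) (simp add: f_cos)
qed

section \<open>Estimates for the cosine and the reflection quotient\<close>

lemma norm_sin_le_exp_Im: "cmod (sin z) \<le> exp \<bar>Im z\<bar>"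
proof -
  have "cmod (sin z) = cmod (exp (\<i> * z) - exp (- (\<i> * z))) / 2"
    by (simp add: sin_exp_eq norm_divide norm_mult)
  also have "\<dots> \<le> (cmod (exp (\<i> * z)) + cmod (exp (- (\<i> * z)))) / 2"
    by (intro divide_right_mono norm_triangle_ineq4) auto
  also have "\<dots> = (exp (- Im z) + exp (Im z)) / 2" by simp
  also have "\<dots> \<le> exp \<bar>Im z\<bar>" by (cases "Im z \<ge> 0") auto
  finally show ?thesis .
qed

lemma exp_le_2: "exp x \<le> 2" if "x \<le> 1/2" for x :: real
proof -
  have "exp x \<le> exp (1/2)" using that by simp
  also have "\<dots> \<le> 2" using exp_bound[of "1/2::real"] by (simp add: power2_eq_square)
  finally show ?thesis .
qed

text \<open>Mean value inequality on the disc: there |Im z| \<le> 1/2, so the derivative is bounded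
  by exp(1/2) \<le> 2.\<close>

lemma norm_cos_diff_le:
  fixes a :: real
  assumes "cmod (w - of_real a) \<le> r" "r \<le> 1/2"
  shows "cmod (cos w - cos (of_real a)) \<le> 2 * r"
proof -
  have r: "0 \<le> r" using assms(1) norm_ge_zero order_trans by blast
  have "cmod (cos w - cos (of_real a)) \<le> 2 * cmod (w - of_real a)"
  proof (rule field_differentiable_bound)
    show "convex (cball (complex_of_real a) r)" by simp
    fix z assume z: "z \<in> cball (complex_of_real a) r"
    show "(cos has_field_derivative - sin z) (at z within cball (of_real a) r)"
      by (auto intro!: derivative_eq_intros)
    have "\<bar>Im z\<bar> \<le> cmod (z - of_real a)" using abs_Im_le_cmod[of "z - of_real a"] by simp
    then have "\<bar>Im z\<bar> \<le> 1/2" using z assms by (simp add: dist_norm norm_minus_commute)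
    then show "cmod (- sin z) \<le> 2" using norm_sin_le_exp_Im[of z] exp_le_2 by fastforce
  qed (use assms r in \<open>simp_all add: dist_norm norm_minus_commute\<close>)
  then show ?thesis using assms by linarith
qed

text \<open>The difference is t (1/e - e) / (1 - t/e), with numerator at most 4/20 and denominator
  at least 9/10; the bound 2/9 is below 1/4.\<close>

lemma reflection_near_1:
  fixes e t :: complex
  assumes "cmod e \<le> 2" "cmod (1 / e) \<le> 2" "cmod t \<le> 1 / 20"
  shows "1 - t / e \<noteq> 0" "cmod ((1 - t * e) / (1 - t / e) - 1) < 1 / 4"
proof -
  have "cmod t * cmod (1 / e) \<le> 1/20 * 2"
    using assms by (intro mult_mono) auto
  then have "cmod (t / e) \<le> 1/20 * 2"
    by (simp add: norm_divide)
  then have den: "cmod (1 - t / e) \<ge> 9/10"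
    using norm_triangle_ineq2[of 1 "t / e"] by simp
  then show nz: "1 - t / e \<noteq> 0" by auto
  have "cmod (1 / e - e) \<le> 4"
    using norm_triangle_ineq4[of "1/e" e] assms by linarith
  then have num: "cmod (t * (1 / e - e)) \<le> 1/20 * 4"
    unfolding norm_mult using assms by (intro mult_mono) auto
  have "(1 - t * e) / (1 - t / e) - 1 = t * (1 / e - e) / (1 - t / e)"
  proof -
    have "t * (1 / e - e) = (1 - t * e) - (1 - t / e)"
      by (simp add: right_diff_distrib)
    then show ?thesis
      using nz diff_divide_distrib[of "1 - t * e" "1 - t / e" "1 - t / e"]
      by (simp only: divide_self[OF nz])
  qed
  then have "cmod ((1 - t * e) / (1 - t / e) - 1) = cmod (t * (1 / e - e)) / cmod (1 - t / e)"
    by (simp add: norm_divide)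
  also have "\<dots> \<le> (1/20 * 4) / (9/10)"
    using num den by (intro frac_le) auto
  finally show "cmod ((1 - t * e) / (1 - t / e) - 1) < 1 / 4" by simp
qed

section \<open>Solving the quantisation condition by Brouwer's theorem\<close>

text \<open>A fixed point of \<open>F\<close> satisfies i N w = i N a + Ln (P w); exponentiating
  gives the last identity. The work lies in showing that \<open>F\<close> is continuous and maps the
  disc \<open>K\<close> of radius 1/N into itself.\<close>

lemma exists_quantised_momentum:
  fixes a h :: real and N :: nat
  assumes N: "N \<ge> 2" "8 / real N \<le> h"
  obtains w z where "cmod (w - of_real a) \<le> 1 / N" "z = 2 * cos w + \<i> * of_real h"
    "cmod (z - (2 * cos (of_real a) + \<i> * of_real h)) \<le> h / 2"
    "exp (\<i> * (of_nat N * w)) * (1 - 1 / (outer_root z + 20 * \<i>) / exp (\<i> * w)) =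
     exp (\<i> * of_real (N * a)) * (1 - 1 / (outer_root z + 20 * \<i>) * exp (\<i> * w))"
proof -
  define z where "z w = 2 * cos w + \<i> * of_real h" for w
  define t where "t w = 1 / (outer_root (z w) + 20 * \<i>)" for w
  define P where "P w = (1 - t w * exp (\<i> * w)) / (1 - t w / exp (\<i> * w))" for w
  define F where "F w = of_real a - \<i> * Ln (P w) / of_nat N" for w
  define K where "K = cball (complex_of_real a) (1 / N)"
  have N0: "real N > 0" using N by simp
  have r: "1 / real N \<le> 1 / 2" using N by (simp add: field_simps)
  have h: "h > 0" using N N0 by (smt (verit) divide_pos_pos)
  \<comment> \<open>The 8 in the hypothesis enters here: z varies by at most 4/N \<le> h/2 on
    \<open>K\<close>, so Im z stays positive and \<open>outer_root\<close> stays continuous.\<close>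
  have zb: "cmod (z w - z (of_real a)) \<le> h / 2" if "w \<in> K" for w
  proof -
    have "cmod (cos w - cos (of_real a)) \<le> 2 * (1 / N)"
      using that r by (intro norm_cos_diff_le) (auto simp: K_def dist_norm norm_minus_commute)
    moreover have "z w - z (of_real a) = 2 * (cos w - cos (of_real a))"
      by (simp add: z_def algebra_simps)
    ultimately have "cmod (z w - z (of_real a)) \<le> 4 / N"
      by (simp add: norm_mult del: distrib_left_numeral right_diff_distrib_numeral)
    also have "\<dots> = (8 / N) / 2" by simp
    also have "\<dots> \<le> h / 2" using N(2) by (rule divide_right_mono) simp
    finally show ?thesis .
  qed
  have Imz: "Im (z w) > 0" if "w \<in> K" for w
  proof -
    have "\<bar>Im (z w - z (of_real a))\<bar> \<le> h / 2" using zb[OF that] abs_Im_le_cmod order_trans by blast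
    moreover have "Im (z w - z (of_real a)) = Im (z w) - h" by (simp add: z_def cos_of_real)
    ultimately show ?thesis using h by linarith
  qed
  have den: "Im (outer_root (z w) + 20 * \<i>) \<ge> 20" if "w \<in> K" for w
    using Im_outer_root_pos[OF Imz[OF that]] by simp
  have tb: "cmod (t w) \<le> 1 / 20" if "w \<in> K" for w
  proof -
    have "20 \<le> cmod (outer_root (z w) + 20 * \<i>)"
      using den[OF that] abs_Im_le_cmod[of "outer_root (z w) + 20 * \<i>"] by linarith
    then show ?thesis by (simp add: t_def norm_divide divide_simps)
  qed
  have eb: "cmod (exp (\<i> * w)) \<le> 2" "cmod (1 / exp (\<i> * w)) \<le> 2" if "w \<in> K" for w
  proof -
    have "\<bar>Im (w - of_real a)\<bar> \<le> 1 / N"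
      using that abs_Im_le_cmod[of "w - of_real a"] by (simp add: K_def dist_norm norm_minus_commute)
    then have "\<bar>Im w\<bar> \<le> 1 / 2" using r by simp
    then have "exp (Im w) \<le> 2" "exp (- Im w) \<le> 2" by (auto intro: exp_le_2)
    then show "cmod (exp (\<i> * w)) \<le> 2" "cmod (1 / exp (\<i> * w)) \<le> 2"
      by (simp_all add: norm_divide exp_minus field_simps)
  qed
  have P1: "1 - t w / exp (\<i> * w) \<noteq> 0" "cmod (P w - 1) < 1 / 4" if "w \<in> K" for w
    using reflection_near_1[OF eb[OF that] tb[OF that]] by (simp_all add: P_def)
  have Pnz: "P w \<notin> \<real>\<^sub>\<le>\<^sub>0" if "w \<in> K" for w
  proof
    assume "P w \<in> \<real>\<^sub>\<le>\<^sub>0"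
    then have "Re (P w - 1) \<le> -1" by (auto simp: complex_nonpos_Reals_iff)
    then show False using P1(2)[OF that] abs_Re_le_cmod[of "P w - 1"] by linarith
  qed
  have "continuous_on K F"
  proof -
    have cz: "continuous_on K z" unfolding z_def by (intro continuous_intros)
    have ct: "continuous_on K t" unfolding t_def
      by (intro continuous_intros cz Imz) (use den in fastforce)+
    have "continuous_on K P" unfolding P_def
      by (intro continuous_intros ct) (use P1 in auto)
    then show ?thesis unfolding F_def
      by (intro continuous_intros) (use Pnz N0 in auto)
  qed
  moreover have "F \<in> K \<rightarrow> K"
  proof
    fix w assume w: "w \<in> K"
    \<comment> \<open>As |P w - 1| < 1/4, the logarithm is smaller than 1/2, and \<open>F w\<close>
      differs from \<open>a\<close> by at most 1/N.\<close>
    have "cmod (Ln (1 + (P w - 1))) \<le> 2 * cmod (P w - 1)"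
      using P1(2)[OF w] by (intro norm_Ln_le) auto
    then have "cmod (Ln (P w)) \<le> 1" using P1(2)[OF w] by simp
    then show "F w \<in> K"
      using N0 by (simp add: K_def F_def dist_norm norm_divide norm_mult divide_right_mono)
  qed
  moreover have "compact K" "convex K" "K \<noteq> {}"
    using N0 by (auto simp: K_def)
  ultimately obtain w where w: "w \<in> K" "F w = w"
    using brouwer[of K F] by blast
  have "\<i> * (of_nat N * w) = \<i> * of_real (N * a) + Ln (P w)"
  proof -
    have "w * of_nat N = F w * of_nat N" using w(2) by simp
    also have "\<dots> = of_nat N * of_real a - \<i> * Ln (P w)"
      using N0 by (simp add: F_def field_simps)
    finally have "\<i> * (of_nat N * w) = \<i> * (of_nat N * of_real a - \<i> * Ln (P w))"
      by (simp add: mult.commute)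
    then show ?thesis by (simp add: algebra_simps)
  qed
  moreover have "P w \<noteq> 0" using Pnz[OF w(1)] by auto
  ultimately have "exp (\<i> * (of_nat N * w)) = exp (\<i> * of_real (N * a)) * P w"
    by (simp add: exp_add)
  then have "exp (\<i> * (of_nat N * w)) * (1 - t w / exp (\<i> * w)) =
     exp (\<i> * of_real (N * a)) * (1 - t w * exp (\<i> * w))"
    using P1(1)[OF w(1)] by (simp add: P_def)
  moreover have "cmod (w - of_real a) \<le> 1 / N"
    using w(1) by (simp add: K_def dist_norm norm_minus_commute)
  moreover have "cmod (z w - (2 * cos (of_real a) + \<i> * of_real h)) \<le> h / 2"
    using zb[OF w(1)] by (simp add: z_def)
  ultimately show ?thesis
    using that[of w "z w"] by (simp add: z_def t_def)
qed


section \<open>Distinct discrete eigenvalues at distance comparable to h\<close>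

text \<open>The centre lies at height h directly above a point of the interval, and z is within h/2
  of it. Imaginary parts give the lower bound, the foot point 2 cos a the upper one.\<close>

lemma infdist_ess_interval_bounds:
  assumes "cmod (z - (2 * cos (complex_of_real a) + \<i> * of_real h)) \<le> h / 2"
  shows "h / 2 \<le> infdist z ess_interval" "infdist z ess_interval \<le> 3 * h / 2"
proof -
  have h: "0 \<le> h" using order_trans[OF norm_ge_zero assms] by simp
  have "\<bar>Im (z - (2 * cos (complex_of_real a) + \<i> * of_real h))\<bar> \<le> h / 2"
    using assms abs_Im_le_cmod order_trans by blast
  moreover have "Im (z - (2 * cos (complex_of_real a) + \<i> * of_real h)) = Im z - h"
    by (simp add: cos_of_real)
  ultimately have Im: "h / 2 \<le> Im z" by linarith
  have "h / 2 \<le> dist z y" if "y \<in> ess_interval" for y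
  proof -
    have "Im (z - y) = Im z" using that by (auto simp: ess_interval_def)
    then show ?thesis using Im abs_Im_le_cmod[of "z - y"] by (simp add: dist_norm)
  qed
  moreover have "ess_interval \<noteq> {}" by (simp add: ess_interval_def)
  ultimately show "h / 2 \<le> infdist z ess_interval"
    by (subst infdist_notempty) (auto intro!: cINF_greatest simp del: divide_le_eq_numeral1)
  have "2 * cos (complex_of_real a) \<in> ess_interval"
    unfolding ess_interval_def
    by (rule image_eqI[of _ _ "2 * cos a"])
      (use cos_le_one[of a] cos_ge_minus_one[of a] in \<open>simp_all add: cos_of_real\<close>)
  then have "infdist z ess_interval \<le> cmod (z - 2 * cos (complex_of_real a))"
    using infdist_le by (metis dist_norm)
  also have "\<dots> \<le> cmod (z - (2 * cos (complex_of_real a) + \<i> * of_real h)) + cmod (\<i> * of_real h)"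
    using norm_triangle_ineq[of "z - (2 * cos (complex_of_real a) + \<i> * of_real h)" "\<i> * of_real h"]
    by simp
  also have "\<dots> \<le> 3 * h / 2" using assms h by (simp add: norm_mult)
  finally show "infdist z ess_interval \<le> 3 * h / 2" .
qed

text \<open>Since e^(iNw) = (E e)^2, dividing the hypothesis by E e turns it into (E e + 1/(E e)) Q
  = E + 1/E. The minus sign selects the cosine solutions; a plus sign would give sines.\<close>

lemma quantised_momentum_even:
  assumes N: "N = 2 * M + 2" and nz: "Q \<noteq> 0"
    and eq: "exp (\<i> * (of_nat N * w)) * (1 - 1 / Q / exp (\<i> * w)) = - (1 - 1 / Q * exp (\<i> * w))"
  shows "cos (of_nat (Suc M) * w) * Q = cos (of_nat M * w)"
proof -
  define e E where "e = exp (\<i> * w)" and "E = exp (\<i> * (of_nat M * w))"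
  have nz': "e \<noteq> 0" "E \<noteq> 0" by (simp_all add: e_def E_def)
  have "exp (\<i> * (of_nat N * w)) = E * E * e * e"
    unfolding E_def e_def N by (simp flip: exp_add add: algebra_simps)
  with eq have "E * E * e * e * (1 - 1 / Q / e) = - (1 - 1 / Q * e)"
    by (simp add: e_def)
  then have "(E * e + 1 / (E * e)) * Q = E + 1 / E"
    using nz nz' by (simp add: divide_simps) (simp add: algebra_simps)
  moreover have "cos (of_nat (Suc M) * w) = (E * e + 1 / (E * e)) / 2"
    unfolding cos_exp_eq E_def e_def exp_minus divide_inverse
    by (simp flip: exp_add add: algebra_simps)
  moreover have "cos (of_nat M * w) = (E + 1 / E) / 2"
    unfolding cos_exp_eq E_def exp_minus divide_inverse by simp
  ultimately show ?thesis by (simp only: times_divide_eq_left)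
qed

text \<open>The centres \<open>a j\<close> are odd multiples of \<pi>/N, so exp(i N a_j) = -1 and
  the even condition holds. Injectivity of j \<mapsto> z_j on \<open>{..M}\<close> gives the
  count.\<close>

lemma barrier_potential_discrete_spectrum:
  fixes h :: real and M :: nat
  assumes h: "8 / real (2 * M + 2) \<le> h"
  obtains Z where "finite Z" "card Z = Suc M" "Z \<subseteq> discrete_spectrum (barrier_potential h M)"
    "\<And>z. z \<in> Z \<Longrightarrow> h / 2 \<le> infdist z ess_interval \<and> infdist z ess_interval \<le> 3 * h / 2"
proof -
  define N where "N = 2 * M + 2"
  define a where "a j = pi * (2 * real j + 1) / N" for j :: nat
  have N: "N \<ge> 2" "8 / real N \<le> h" "real N = 2 * real M + 2" using h by (auto simp: N_def)
  have h0: "h > 0" using N by (smt (verit) divide_pos_pos of_nat_0_le_iff)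
  define P where "P j w z \<longleftrightarrow> cmod (w - of_real (a j)) \<le> 1 / N \<and> z = 2 * cos w + \<i> * of_real h \<and>
    cmod (z - (2 * cos (of_real (a j)) + \<i> * of_real h)) \<le> h / 2 \<and>
    exp (\<i> * (of_nat N * w)) * (1 - 1 / (outer_root z + 20 * \<i>) / exp (\<i> * w)) =
     exp (\<i> * of_real (N * a j)) * (1 - 1 / (outer_root z + 20 * \<i>) * exp (\<i> * w))" for j w z
  have "\<exists>w z. P j w z" for j
    using exists_quantised_momentum[OF N(1,2), of "a j"] unfolding P_def by metis
  then obtain w z where "\<And>j. P j (w j) (z j)" by metis
  then have w: "cmod (w j - of_real (a j)) \<le> 1 / N"
    and z: "z j = 2 * cos (w j) + \<i> * of_real h"
    and dist: "cmod (z j - (2 * cos (of_real (a j)) + \<i> * of_real h)) \<le> h / 2"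
    and quant: "exp (\<i> * (of_nat N * w j)) * (1 - 1 / (outer_root (z j) + 20 * \<i>) / exp (\<i> * w j)) =
     exp (\<i> * of_real (N * a j)) * (1 - 1 / (outer_root (z j) + 20 * \<i>) * exp (\<i> * w j))" for j
    unfolding P_def by blast+
  have disc: "z j \<in> discrete_spectrum (barrier_potential h M)" for j
  proof -
    have "infdist (z j) ess_interval > 0"
      using infdist_ess_interval_bounds(1)[OF dist[of j]] h0 by linarith
    then have notin: "z j \<notin> ess_interval" by auto
    have "\<bar>Im (z j - (2 * cos (complex_of_real (a j)) + \<i> * of_real h))\<bar> \<le> h / 2"
      using dist abs_Im_le_cmod order_trans by blast
    moreover have "Im (z j - (2 * cos (complex_of_real (a j)) + \<i> * of_real h)) = Im (z j) - h"
      by (simp add: cos_of_real)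
    ultimately have Im: "Im (z j) > 0" using h0 by linarith
    have "Im (outer_root (z j) + 20 * \<i>) > 0"
      using Im_outer_root_pos[OF Im] by simp
    then have nz: "outer_root (z j) + 20 * \<i> \<noteq> 0" by (metis zero_complex.sel(2) less_irrefl)
    have "real N \<noteq> 0" using N by simp
    then have "real N * a j = pi * (2 * real j + 1)"
      unfolding a_def by simp
    also have "\<dots> = 2 * pi * real j + pi" by (simp add: algebra_simps)
    finally have "real N * a j = 2 * pi * real j + pi" .
    then have "exp (\<i> * of_real (N * a j)) = cis (2 * pi * real j) * cis pi"
      by (simp only: cis_mult flip: cis_conv_exp)
    then have "exp (\<i> * of_real (N * a j)) = -1"
      by (simp add: cis_multiple_2pi)
    then have "cos (of_nat (Suc M) * w j) * (outer_root (z j) + 20 * \<i>) = cos (of_nat M * w j)"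
      using quant[of j] by (intro quantised_momentum_even[OF N_def nz]) simp
    from barrier_potential_eigenvalue[OF z outer_root_add_inverse[OF Im] norm_outer_root_gt_1[OF Im] this]
    show ?thesis using notin by (simp add: discrete_spectrum_def)
  qed
  have "inj_on z {..M}"
  proof (rule inj_onI)
    fix i j assume ij: "i \<in> {..M}" "j \<in> {..M}" and eq: "z i = z j"
    have Re: "\<bar>Re (w k) - a k\<bar> \<le> 1 / N" for k
      using w[of k] abs_Re_le_cmod[of "w k - of_real (a k)"] by simp
    \<comment> \<open>For k \<le> M the centre is at least \<pi>/N > 1/N away from 0 and \<pi>, so
      the whole disc lies in the strip 0 < Re < \<pi>.\<close>
    have rng: "0 < Re (w k) \<and> Re (w k) < pi" if "k \<in> {..M}" for k
    proof -
      have "1 / N < pi / N" using N pi_gt3 by (simp add: divide_strict_right_mono)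
      moreover have "pi / N \<le> a k"
        unfolding a_def by (intro divide_right_mono) auto
      moreover have "a k + pi / N \<le> pi"
      proof -
        have "a k + pi / N = pi * ((2 * real k + 2) / N)"
          by (simp add: a_def add_divide_distrib algebra_simps)
        also have "\<dots> \<le> pi * 1"
          using that N by (intro mult_left_mono) auto
        finally show ?thesis by simp
      qed
      ultimately show ?thesis using Re[of k] by linarith
    qed
    have "cos (w i) = cos (w j)" using eq by (simp add: z)
    \<comment> \<open>Equal cosines mean w_i = \<plusminus>w_j up to a multiple of 2\<pi>. In the
      strip the minus sign is impossible, as the sum of the real parts lies strictly between 0 and
      2\<pi>, and the plus sign forces multiple 0.\<close>
    then obtain n where n: "n \<in> \<int>" "w i = w j + of_real (2 * n * pi) \<or> w i = - w j + of_real (2 * n * pi)"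
      unfolding complex_cos_eq by blast
    then obtain m where m: "n = of_int m" by (auto elim: Ints_cases)
    from n(2) have "Re (w i) - Re (w j) = of_int m * (2 * pi) \<or> Re (w i) + Re (w j) = of_int m * (2 * pi)"
      by (auto simp: m)
    then have "Re (w i) - Re (w j) = 0"
    proof
      assume *: "Re (w i) - Re (w j) = of_int m * (2 * pi)"
      then have "of_int m * (2 * pi) < 1 * (2 * pi)" "(-1) * (2 * pi) < of_int m * (2 * pi)"
        using rng[OF ij(1)] rng[OF ij(2)] by linarith+
      then have "real_of_int m < 1" "-1 < real_of_int m"
        using pi_gt_zero by (simp_all only: mult_less_cancel_right)
      then have "m = 0" by linarith
      then show ?thesis using * by simp
    next
      assume *: "Re (w i) + Re (w j) = of_int m * (2 * pi)"
      then have "of_int m * (2 * pi) < 1 * (2 * pi)" "0 * (2 * pi) < of_int m * (2 * pi)"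
        using rng[OF ij(1)] rng[OF ij(2)] by linarith+
      then have "real_of_int m < 1" "0 < real_of_int m"
        using pi_gt_zero by (simp_all only: mult_less_cancel_right)
      then have "m < 1" "0 < m" by simp_all
      then show ?thesis by linarith
    qed
    \<comment> \<open>Both centres are within 1/N of the same real part, whereas distinct centres
      are at least 2\<pi>/N apart.\<close>
    then have "\<bar>a i - a j\<bar> \<le> 2 / N" using Re[of i] Re[of j] by linarith
    moreover have "a i - a j = 2 * pi * (real i - real j) / N"
      by (simp add: a_def algebra_simps flip: diff_divide_distrib)
    ultimately have "2 * pi * \<bar>real i - real j\<bar> / N \<le> 2 / N"
      by (simp add: abs_mult)
    then have "pi * \<bar>real i - real j\<bar> \<le> 1"
      using N by (simp add: divide_le_cancel)
    moreover have "pi * 1 \<le> pi * \<bar>real i - real j\<bar>" if "1 \<le> \<bar>real i - real j\<bar>"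
      using that by (intro mult_left_mono) auto
    ultimately have "\<bar>real i - real j\<bar> < 1"
      using pi_gt3 by linarith
    then show "i = j" by linarith
  qed
  then have "card (z ` {..M}) = Suc M" by (simp add: card_image)
  then show ?thesis
    using that[of "z ` {..M}"] disc infdist_ess_interval_bounds[OF dist] by auto
qed

section \<open>The norm of the potential and the unbounded ratio\<close>

lemma barrier_potential_lp:
  fixes h p :: real
  assumes h: "h > 0" and p: "p \<ge> 0"
  shows barrier_potential_in_lp_space: "barrier_potential h M \<in> lp_space p"
    and lp_norm_pow_barrier_potential:
      "lp_norm_pow p (barrier_potential h M) = (2 * real M + 1) * h powr p + 2 * 20 powr p"
proof -
  let ?b = "barrier_potential h M" and ?S = "{- int (Suc M)..int (Suc M)}"
  have supp: "{n. ?b n \<noteq> 0} = ?S"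
    using h by (auto simp: barrier_potential_def)
  have S: "?S = {- int M..int M} \<union> {int (Suc M), - int (Suc M)}" by auto
  have "(\<Sum>n\<in>?S. cmod (?b n) powr p)
      = (\<Sum>n\<in>{- int M..int M}. cmod (?b n) powr p) + (\<Sum>n\<in>{int (Suc M), - int (Suc M)}. cmod (?b n) powr p)"
    unfolding S by (rule sum.union_disjoint) auto
  also have "(\<Sum>n\<in>{- int M..int M}. cmod (?b n) powr p) = (\<Sum>n\<in>{- int M..int M}. h powr p)"
    using h by (intro sum.cong) (auto simp: barrier_potential_def norm_mult)
  also have "\<dots> = (2 * real M + 1) * h powr p" by simp
  also have "(\<Sum>n\<in>{int (Suc M), - int (Suc M)}. cmod (?b n) powr p) = 2 * 20 powr p"
    by (simp add: barrier_potential_def norm_mult)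
  finally have sum: "(\<Sum>n\<in>?S. cmod (?b n) powr p) = (2 * real M + 1) * h powr p + 2 * 20 powr p" .
  have has: "((\<lambda>n. cmod (?b n) powr p) has_sum (\<Sum>n\<in>?S. cmod (?b n) powr p)) UNIV"
    using supp by (intro has_sum_finite_neutralI) auto
  show "?b \<in> lp_space p"
    using has supp by (auto simp: lp_space_def summable_on_def)
  show "lp_norm_pow p ?b = (2 * real M + 1) * h powr p + 2 * 20 powr p"
  proof (cases "p = 0")
    \<comment> \<open>At exponent 0 both powers equal 1 and the formula gives 2M + 3, the size of
      the support.\<close>
    case True
    then show ?thesis unfolding lp_norm_pow_def supp using h by simp
  next
    case False
    then show ?thesis using infsumI[OF has] sum by (simp add: lp_norm_pow_def)
  qed
qed

text \<open>For negative \<omega> the power is decreasing, so the upper bound on \<open>d\<close> is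
  the one that counts; the constant with |\<omega>| covers both signs.\<close>

lemma powr_ge_of_comparable:
  fixes d h \<omega> :: real
  assumes "h > 0" "h / 2 \<le> d" "d \<le> 2 * h"
  shows "2 powr (- \<bar>\<omega>\<bar>) * h powr \<omega> \<le> d powr \<omega>"
proof (cases "\<omega> \<ge> 0")
  case True
  have "2 powr (- \<bar>\<omega>\<bar>) * h powr \<omega> = (h / 2) powr \<omega>"
    using True assms(1) by (simp add: powr_divide powr_minus field_simps)
  also have "\<dots> \<le> d powr \<omega>" using True assms by (intro powr_mono2) auto
  finally show ?thesis .
next
  case False
  have "2 powr (- \<bar>\<omega>\<bar>) * h powr \<omega> = (2 * h) powr \<omega>"
    using False assms(1) by (simp add: powr_mult)
  also have "\<dots> \<le> d powr \<omega>" using False assms by (intro powr_mono2') auto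
  finally show ?thesis .
qed

text \<open>By \<open>M\<close> the two barriers cost at most (M+1) h^p, so the norm is at most 3
  (M+1) h^p. The M + 1 eigenvalues contribute at least 2^(-|\<omega>|) h^\<omega> each, and M + 1
  cancels.\<close>

lemma barrier_potential_ratio:
  fixes h p \<omega> :: real
  assumes h: "h > 0" "8 / real (2 * M + 2) \<le> h" and p: "p \<ge> 0"
    and M: "2 * 20 powr p \<le> real (Suc M) * h powr p"
  shows "ennreal (2 powr (- \<bar>\<omega>\<bar>) / 3 * h powr (\<omega> - p)) \<le>
    1 / ennreal (lp_norm_pow p (barrier_potential h M)) *
      (\<Sum>\<^sub>\<infinity>z\<in>discrete_spectrum (barrier_potential h M). ennreal (infdist z ess_interval powr \<omega>))"
proof -
  let ?b = "barrier_potential h M" and ?d = "\<lambda>z. infdist z ess_interval powr \<omega>"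
  define c where "c = 2 powr (- \<bar>\<omega>\<bar>)"
  define L where "L = lp_norm_pow p ?b"
  obtain Z where Z: "finite Z" "card Z = Suc M" "Z \<subseteq> discrete_spectrum ?b"
    and dist: "\<And>z. z \<in> Z \<Longrightarrow> h / 2 \<le> infdist z ess_interval \<and> infdist z ess_interval \<le> 3 * h / 2"
    using barrier_potential_discrete_spectrum[OF h(2)] by blast
  have L: "L = (2 * real M + 1) * h powr p + 2 * 20 powr p"
    unfolding L_def by (rule lp_norm_pow_barrier_potential[OF h(1) p])
  have "0 < (2 * real M + 1) * h powr p" using h(1) by (intro mult_pos_pos) auto
  then have L0: "L > 0" unfolding L using powr_ge_zero[of 20 p] by linarith
  have "(2 * real M + 1) * h powr p + real (Suc M) * h powr p \<le> 3 * real (Suc M) * h powr p"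
    by (simp add: algebra_simps)
  then have L3: "L \<le> 3 * real (Suc M) * h powr p" using M unfolding L by linarith
  have summand: "c * h powr \<omega> \<le> ?d z" if "z \<in> Z" for z
    unfolding c_def using dist[OF that] h(1) by (intro powr_ge_of_comparable) auto
  have "ennreal (real (Suc M) * (c * h powr \<omega>)) \<le> ennreal (\<Sum>z\<in>Z. ?d z)"
    using sum_mono[of Z "\<lambda>_. c * h powr \<omega>" ?d] summand Z(2) by (intro ennreal_leI) simp
  also have "\<dots> = (\<Sum>z\<in>Z. ennreal (?d z))" by simp
  also have "\<dots> = (\<Sum>\<^sub>\<infinity>z\<in>Z. ennreal (?d z))" using Z(1) by simp
  also have "\<dots> \<le> (\<Sum>\<^sub>\<infinity>z\<in>discrete_spectrum ?b. ennreal (?d z))"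
    using Z(3) by (intro infsum_mono_neutral nonneg_summable_on_complete) auto
  finally have S: "ennreal (real (Suc M) * (c * h powr \<omega>)) \<le> \<dots>" .
  have "c / 3 * h powr (\<omega> - p) * L \<le> c / 3 * h powr (\<omega> - p) * (3 * real (Suc M) * h powr p)"
    using L3 by (intro mult_left_mono) (auto simp: c_def)
  also have "\<dots> = real (Suc M) * (c * (h powr (\<omega> - p) * h powr p))" by simp
  also have "h powr (\<omega> - p) * h powr p = h powr \<omega>" by (simp flip: powr_add)
  finally have "c / 3 * h powr (\<omega> - p) \<le> 1 / L * (real (Suc M) * (c * h powr \<omega>))"
    using L0 by (simp add: field_simps)
  then have "ennreal (c / 3 * h powr (\<omega> - p)) \<le> ennreal (1 / L * (real (Suc M) * (c * h powr \<omega>)))"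
    by (rule ennreal_leI)
  also have "\<dots> = 1 / ennreal L * ennreal (real (Suc M) * (c * h powr \<omega>))"
    using L0 by (subst ennreal_mult) (auto simp: c_def divide_ennreal simp flip: ennreal_1)
  also have "\<dots> \<le> 1 / ennreal L * (\<Sum>\<^sub>\<infinity>z\<in>discrete_spectrum ?b. ennreal (?d z))"
    by (rule mult_left_mono[OF S]) simp
  finally show ?thesis by (simp only: c_def L_def)
qed

theorem theorem2:
  fixes p \<omega> :: real
  assumes "p \<ge> 0" and "\<omega> < p"
  shows "(SUP b\<in>{b \<in> lp_space p. b \<noteq> (\<lambda>_. 0)}.
            1 / ennreal (lp_norm_pow p b) *
            (\<Sum>\<^sub>\<infinity>z\<in>discrete_spectrum b. ennreal (infdist z ess_interval powr \<omega>))) = (\<infinity> :: ennreal)"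
proof -
  define c where "c = 2 powr (- \<bar>\<omega>\<bar>) / 3"
  have c: "c > 0" by (simp add: c_def)
  have "\<exists>b\<in>{b \<in> lp_space p. b \<noteq> (\<lambda>_. 0)}. x < 1 / ennreal (lp_norm_pow p b) *
            (\<Sum>\<^sub>\<infinity>z\<in>discrete_spectrum b. ennreal (infdist z ess_interval powr \<omega>))"
    if x: "x < top" for x :: ennreal
  proof -
    obtain r where r: "x = ennreal r" "0 \<le> r"
      using x by (cases x) auto
    \<comment> \<open>The solution of c h^(\<omega>-p) = r + 1, which exceeds the prescribed bound
      r; the exponent is nonzero because \<omega> < p.\<close>
    define h where "h = ((r + 1) / c) powr (1 / (\<omega> - p))"
    have h0: "h > 0" using r c by (simp add: h_def)
    have hc: "c * h powr (\<omega> - p) = r + 1"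
      using r c assms(2) by (simp add: h_def powr_powr)
    \<comment> \<open>With h fixed, the first bound yields 8/(2M+2) = 4/(M+1) \<le> h for the fixed
      point argument, the second makes the barrier cost at most (M+1) h^p.\<close>
    obtain M :: nat where M: "max (4 / h) (2 * 20 powr p / h powr p) \<le> real M"
      using real_arch_simple by blast
    have "4 / h \<le> real (Suc M)" "2 * 20 powr p / h powr p \<le> real (Suc M)"
      using M by auto
    then have M1: "8 / real (2 * M + 2) \<le> h" and M2: "2 * 20 powr p \<le> real (Suc M) * h powr p"
      using h0 by (simp_all add: field_simps)
    have "x < ennreal (c * h powr (\<omega> - p))"
      using r hc by (simp add: ennreal_lessI)
    also note barrier_potential_ratio[OF h0 M1 assms(1) M2, of \<omega>, folded c_def]
    finally have "x < 1 / ennreal (lp_norm_pow p (barrier_potential h M)) *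
        (\<Sum>\<^sub>\<infinity>z\<in>discrete_spectrum (barrier_potential h M). ennreal (infdist z ess_interval powr \<omega>))" .
    moreover have "barrier_potential h M \<noteq> (\<lambda>_. 0)"
      using h0 by (auto simp: barrier_potential_def fun_eq_iff intro!: exI[of _ 0])
    ultimately show ?thesis
      using barrier_potential_in_lp_space[OF h0 assms(1)] by blast
  qed
  then show ?thesis
    unfolding infinity_ennreal_def SUP_eq_top_iff by blast
qed

end
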